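(* Let $E$ be the elliptic curve $y^2=x^3+D(ax+b)^2$ with $a,b,D\in\mathbb{Z}$, $D\neq1$ a fundamental discriminant, $b>0$, $4Da^3\neq 27b$, and such that writing $b=b_1b_3^3$ with $b_1$ cubefree we have $\gcd(a,b_3)=1$. Let $K=\mathbb{Q}(\sqrt D)$, $\tau$ the nontrivial automorphism of $K$, $G_3$ the subgroup of $K^*/{K^*}^3$ of classes $[u]$ with $u\tau(u)\in{\mathbb{Q}^*}^3$, and $\alpha:E(\mathbb{Q})\to G_3$ given by $\alpha(O)=1$ and $\alpha((x,y))=[y-(ax+b)\sqrt D]$. (1) A class $[u]\in G_3$ belongs to the image of $\alpha$ if and only if for some (equivalently, any) representative $u\in K^*$ of the form $u=v^2\tau(v)$, with $v=v_1+v_2\sqrt D$, $v_1,v_2\in\mathbb{Q}$, the homogeneous cubic equation $$2v_2X^3+2Dv_1Y^3+\frac{2b}{v_1^2-Dv_2^2}Z^3+6v_1X^2Y+6v_2DXY^2+2a(X^2Z-DY^2Z)=0$$ has a nontrivial integer (equivalently, rational) solution. (2) More precisely, for $u=1$ (i.e. $v=1$) it has the solution $(X,Y,Z)=(1,0,0)$, and if $(x,y)\in E(\mathbb{Q})$ satisfies $y-(ax+b)\sqrt D=v^2\tau(v)z^3$ for some $z=z_1+z_2\sqrt D\in K^*$ ($z_1,z_2\in\mathbb{Q}$), it has the solution $(X,Y,Z)=(z_1,z_2,1)$. Conversely, if $(X,Y,Z)$ is a solution with $Z\neq0$, then $$(x,y)=\left(v\tau(v)\frac{X^2-DY^2}{Z^2},\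 v\tau(v)\frac{\Re\big(v(X+Y\sqrt D)^3\big)}{Z^3}\right)$$ is a preimage of $[u]$ in $E(\mathbb{Q})$, with $y-(ax+b)\sqrt D=u z^3$ for $z=(X+Y\sqrt D)/Z$.
   Context: Here $\Re(\beta)$ denotes $(\beta+\tau(\beta))/2$ for $\beta\in K$. $O$ is the point at infinity. Solutions of homogeneous equations are understood to be nontrivial. *)

theory Defs
  imports Complex_Main "HOL-Algebra.Coset" "HOL-Computational_Algebra.Squarefree"
begin

definition fundamental_discriminant :: "int \<Rightarrow> bool" where
  "fundamental_discriminant D \<longleftrightarrow>
     (D mod 4 = 1 \<and> squarefree D) \<or>
     (4 dvd D \<and> (D div 4) mod 4 \<in> {2, 3} \<and> squarefree (D div 4))"

definition cubefree :: "int \<Rightarrow> bool" where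
  "cubefree n \<longleftrightarrow> (\<forall>k. k ^ 3 dvd n \<longrightarrow> is_unit k)"

text \<open>
  The field \<open>K = \<rat>(\<surd>D)\<close> is realised inside the complex numbers, with \<^term>\<open>csqrt (of_int D)\<close> as
  the chosen square root of \<open>D\<close>.
\<close>

definition quad :: "int \<Rightarrow> rat \<Rightarrow> rat \<Rightarrow> complex" where
  "quad D p q = of_rat p + of_rat q * csqrt (of_int D)"

definition quad_field :: "int \<Rightarrow> complex set" where
  "quad_field D = {quad D p q | p q. True}"

definition quad_units :: "int \<Rightarrow> complex monoid" where
  "quad_units D = \<lparr>carrier = quad_field D - {0}, monoid.mult = (*), one = 1\<rparr>"

text \<open>
  If \<open>D\<close> is not a square, then the components \<open>p\<close> and \<open>q\<close> are determined by \<open>z\<close>, so the description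
  below is proper on \<^term>\<open>quad_field D\<close>; see \<open>tau_quad\<close>.
\<close>

definition tau :: "int \<Rightarrow> complex \<Rightarrow> complex" where
  "tau D z = (THE w. \<exists>p q. z = quad D p q \<and> w = quad D p (- q))"

definition quad_Re :: "int \<Rightarrow> complex \<Rightarrow> complex" where
  "quad_Re D z = (z + tau D z) / 2"

definition unit_cubes :: "int \<Rightarrow> complex set" where
  "unit_cubes D = {z ^ 3 | z. z \<in> carrier (quad_units D)}"

definition cube_quotient :: "int \<Rightarrow> complex set monoid" where
  "cube_quotient D = quad_units D Mod unit_cubes D"

definition cube_class :: "int \<Rightarrow> complex \<Rightarrow> complex set" where
  "cube_class D u = unit_cubes D #>\<^bsub>quad_units D\<^esub> u"

definition G3 :: "int \<Rightarrow> complex set set" where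
  "G3 D = {cube_class D u | u. u \<in> carrier (quad_units D) \<and>
             (\<exists>r::rat. r \<noteq> 0 \<and> u * tau D u = of_rat (r ^ 3))}"

datatype point = Infinity | Affine rat rat

definition E_points :: "int \<Rightarrow> int \<Rightarrow> int \<Rightarrow> point set" where
  "E_points D a b = insert Infinity
     {Affine x y | x y. y ^ 2 = x ^ 3 + of_int D * (of_int a * x + of_int b) ^ 2}"

text \<open>The argument of the class is \<open>y - (a x + b) \<surd>D\<close>.\<close>

fun alpha :: "int \<Rightarrow> int \<Rightarrow> int \<Rightarrow> point \<Rightarrow> complex set" where
  "alpha D a b Infinity = \<one>\<^bsub>cube_quotient D\<^esub>"
| "alpha D a b (Affine x y) = cube_class D (quad D y (- (of_int a * x + of_int b)))"

definition descent_cubic ::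
    "int \<Rightarrow> int \<Rightarrow> int \<Rightarrow> rat \<Rightarrow> rat \<Rightarrow> rat \<Rightarrow> rat \<Rightarrow> rat \<Rightarrow> rat" where
  "descent_cubic D a b v1 v2 X Y Z =
     2 * v2 * X ^ 3 + 2 * of_int D * v1 * Y ^ 3
     + 2 * of_int b / (v1 ^ 2 - of_int D * v2 ^ 2) * Z ^ 3
     + 6 * v1 * X ^ 2 * Y + 6 * v2 * of_int D * X * Y ^ 2
     + 2 * of_int a * (X ^ 2 * Z - of_int D * Y ^ 2 * Z)"

definition cubic_solution ::
    "int \<Rightarrow> int \<Rightarrow> int \<Rightarrow> rat \<Rightarrow> rat \<Rightarrow> rat \<Rightarrow> rat \<Rightarrow> rat \<Rightarrow> bool" where
  "cubic_solution D a b v1 v2 X Y Z \<longleftrightarrow>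
     (X, Y, Z) \<noteq> (0, 0, 0) \<and> descent_cubic D a b v1 v2 X Y Z = 0"

definition rat_solvable :: "int \<Rightarrow> int \<Rightarrow> int \<Rightarrow> rat \<Rightarrow> rat \<Rightarrow> bool" where
  "rat_solvable D a b v1 v2 \<longleftrightarrow> (\<exists>X Y Z. cubic_solution D a b v1 v2 X Y Z)"

definition int_solvable :: "int \<Rightarrow> int \<Rightarrow> int \<Rightarrow> rat \<Rightarrow> rat \<Rightarrow> bool" where
  "int_solvable D a b v1 v2 \<longleftrightarrow>
     (\<exists>X Y Z :: int. cubic_solution D a b v1 v2 (of_int X) (of_int Y) (of_int Z))"

definition represents :: "int \<Rightarrow> complex set \<Rightarrow> rat \<Rightarrow> rat \<Rightarrow> bool" where
  "represents D U v1 v2 \<longleftrightarrow>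
     quad D v1 v2 \<in> carrier (quad_units D) \<and>
     cube_class D (quad D v1 v2 ^ 2 * tau D (quad D v1 v2)) = U"

lemma csqrt_sq: "csqrt (of_int D) * csqrt (of_int D) = of_int D"
  by (simp only: power2_csqrt flip: power2_eq_square)

lemma fundamental_discriminant_not_square:
  assumes "fundamental_discriminant D" "D \<noteq> 1"
  shows "(r::rat) ^ 2 \<noteq> of_int D"
proof
  assume r: "r ^ 2 = of_int D"
  obtain m n where mn: "quotient_of r = (m, n)" by (cases "quotient_of r") auto
  have n: "n > 0" "coprime m n" "r = of_int m / of_int n"
    using mn quotient_of_denom_pos quotient_of_coprime quotient_of_div by blast+
  have "(of_int (m ^ 2) :: rat) = of_int (D * n ^ 2)"
    using r n by (simp add: field_simps power2_eq_square)
  hence e: "m ^ 2 = D * n ^ 2" by (simp only: of_int_eq_iff)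
  hence "n ^ 2 dvd m ^ 2" by simp
  hence "n dvd m" by simp
  hence "n = 1" using n by (metis coprime_common_divisor dvd_refl zdvd1_eq abs_of_pos)
  hence D: "D = m ^ 2" using e by simp
  from assms(1) show False unfolding fundamental_discriminant_def
  proof (elim disjE conjE)
    assume "squarefree D"
    hence "is_unit m" using D by (intro squarefreeD[of D]) simp_all
    hence "D = 1" using D by (auto simp: power2_eq_1_iff abs_if split: if_splits)
    thus False using assms by simp
  next
    assume h: "4 dvd D" "squarefree (D div 4)" "D div 4 mod 4 \<in> {2,3}"
    have "even m" using h D by (metis dvd_trans even_numeral even_power)
    then obtain k where k: "m = 2 * k" by blast
    have kk: "D div 4 = k ^ 2" using D k by (simp add: power_mult_distrib)
    hence "is_unit k" using h(2) by (intro squarefreeD[of "D div 4"]) simp_all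
    hence "D div 4 = 1" using kk by (auto simp: power2_eq_1_iff abs_if split: if_splits)
    thus False using h by simp
  qed
qed

context
  fixes D :: int
  assumes D: "fundamental_discriminant D" "D \<noteq> 1"
begin

lemma quad_eq_iff: "quad D p q = quad D p' q' \<longleftrightarrow> p = p' \<and> q = q'"
proof
  assume e: "quad D p q = quad D p' q'"
  define s where "s = csqrt (of_int D)"
  have s: "s * s = of_int D" by (simp add: s_def csqrt_sq)
  have e1: "of_rat (q - q') * s = (of_rat (p' - p) :: complex)"
    using e by (simp add: quad_def s_def of_rat_diff algebra_simps)
  have "q = q'"
  proof (rule ccontr)
    assume q: "q \<noteq> q'"
    hence "s = of_rat ((p' - p) / (q - q'))"
      using e1 by (simp add: of_rat_divide field_simps)
    hence "of_rat (((p' - p) / (q - q')) ^ 2) = (of_rat (of_int D) :: complex)"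
      using s by (simp only: power2_eq_square of_rat_mult of_rat_of_int_eq)
    hence "((p' - p) / (q - q')) ^ 2 = of_int D" by (simp only: of_rat_eq_iff)
    thus False using fundamental_discriminant_not_square[OF D] by blast
  qed
  thus "p = p' \<and> q = q'" using e by (simp add: quad_def)
qed auto

lemma tau_quad: "tau D (quad D p q) = quad D p (- q)"
  unfolding tau_def by (rule the_equality) (auto simp: quad_eq_iff)

lemma quad_mult: "quad D p q * quad D p' q' = quad D (p * p' + of_int D * q * q') (p * q' + q * p')"
proof -
  define s where "s = csqrt (of_int D)"
  have "s * s = of_int D" by (simp add: s_def csqrt_sq)
  hence e: "of_int D = s * s" by simp
  show ?thesis
    unfolding quad_def s_def[symmetric] of_rat_add of_rat_mult of_rat_of_int_eq e by algebra
qed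

lemma quad_zero_iff: "quad D p q = 0 \<longleftrightarrow> p = 0 \<and> q = 0"
  using quad_eq_iff[of p q 0 0] by (simp add: quad_def)

lemma quad_norm_nonzero:
  fixes p q :: rat
  assumes "p \<noteq> 0 \<or> q \<noteq> 0" shows "p ^ 2 - of_int D * q ^ 2 \<noteq> 0"
proof
  assume e: "p ^ 2 - of_int D * q ^ 2 = 0"
  show False
  proof (cases "q = 0")
    case False
    hence "(p / q) ^ 2 = of_int D" using e by (simp add: field_simps)
    thus False using fundamental_discriminant_not_square[OF D] by blast
  qed (use e assms in auto)
qed

lemma tau_mult:
  assumes "z \<in> quad_field D" "w \<in> quad_field D"
  shows "tau D (z * w) = tau D z * tau D w"
  using assms by (auto simp: quad_field_def quad_mult tau_quad algebra_simps)

lemma quad_units_inverse: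
  assumes "z \<in> quad_field D - {0}" shows "inverse z \<in> quad_field D - {0}"
proof -
  obtain p q where z: "z = quad D p q" using assms by (auto simp: quad_field_def)
  have pq: "p \<noteq> 0 \<or> q \<noteq> 0" using assms z by (auto simp: quad_zero_iff)
  define N where "N = p ^ 2 - of_int D * q ^ 2"
  have N: "N \<noteq> 0" using quad_norm_nonzero[OF pq] by (simp add: N_def)
  have "p * (p / N) + of_int D * q * (- q / N) = 1" "p * (- q / N) + q * (p / N) = 0"
    using N by (simp_all add: field_simps) (simp add: N_def power2_eq_square)
  hence "z * quad D (p / N) (- q / N) = quad D 1 0" unfolding z quad_mult by simp
  hence "z * quad D (p / N) (- q / N) = 1" by (simp add: quad_def)
  hence "inverse z = quad D (p / N) (- q / N)" by (rule inverse_unique)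
  thus ?thesis using assms by (auto simp: quad_field_def)
qed

lemma quad_field_mult: "z \<in> quad_field D \<Longrightarrow> w \<in> quad_field D \<Longrightarrow> z * w \<in> quad_field D"
  unfolding quad_field_def using quad_mult by blast

lemma one_quad_field: "1 \<in> quad_field D"
proof -
  have "1 = quad D 1 0" by (simp add: quad_def)
  thus ?thesis unfolding quad_field_def by blast
qed

lemma comm_group_quad_units: "comm_group (quad_units D)"
proof (rule comm_groupI)
  fix x assume x: "x \<in> carrier (quad_units D)"
  show "\<exists>y\<in>carrier (quad_units D). y \<otimes>\<^bsub>quad_units D\<^esub> x = \<one>\<^bsub>quad_units D\<^esub>"
    using x quad_units_inverse[of x]
    by (intro bexI[of _ "inverse x"]) (auto simp: quad_units_def)
qed (auto simp: quad_units_def quad_field_mult one_quad_field)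

lemma inv_quad_units:
  assumes "x \<in> carrier (quad_units D)" shows "inv\<^bsub>quad_units D\<^esub> x = inverse x"
proof -
  interpret comm_group "quad_units D" by (rule comm_group_quad_units)
  show ?thesis
    using assms quad_units_inverse[of x]
    by (intro inv_equality) (auto simp: quad_units_def)
qed

lemma subgroup_unit_cubes: "subgroup (unit_cubes D) (quad_units D)"
proof -
  interpret comm_group "quad_units D" by (rule comm_group_quad_units)
  have cl: "z ^ 3 \<in> carrier (quad_units D)" if "z \<in> carrier (quad_units D)" for z
    using that by (auto simp: quad_units_def quad_field_mult power3_eq_cube)
  show ?thesis
  proof (rule subgroupI)
    show "unit_cubes D \<subseteq> carrier (quad_units D)" using cl by (auto simp: unit_cubes_def)
    show "unit_cubes D \<noteq> {}" using one_closed by (auto simp: unit_cubes_def)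
  next
    fix x assume x: "x \<in> unit_cubes D"
    then obtain z where z: "z \<in> carrier (quad_units D)" "x = z ^ 3" by (auto simp: unit_cubes_def)
    have "inv\<^bsub>quad_units D\<^esub> x = inverse z ^ 3" using z cl by (simp add: inv_quad_units power_inverse)
    moreover have "inverse z \<in> carrier (quad_units D)"
      using z quad_units_inverse[of z] by (simp add: quad_units_def)
    ultimately show "inv\<^bsub>quad_units D\<^esub> x \<in> unit_cubes D" unfolding unit_cubes_def by blast
  next
    fix x y assume "x \<in> unit_cubes D" "y \<in> unit_cubes D"
    then obtain z w where "z \<in> carrier (quad_units D)" "x = z ^ 3"
      "w \<in> carrier (quad_units D)" "y = w ^ 3" by (auto simp: unit_cubes_def)
    hence "z * w \<in> carrier (quad_units D)" "x \<otimes>\<^bsub>quad_units D\<^esub> y = (z * w) ^ 3"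
      by (auto simp: quad_units_def quad_field_mult power_mult_distrib)
    thus "x \<otimes>\<^bsub>quad_units D\<^esub> y \<in> unit_cubes D" unfolding unit_cubes_def by blast
  qed
qed

lemma normal_unit_cubes: "unit_cubes D \<lhd> quad_units D"
  using comm_group.normal_iff_subgroup comm_group_quad_units subgroup_unit_cubes by blast

lemma group_cube_quotient: "group (cube_quotient D)"
  unfolding cube_quotient_def using normal.factorgroup_is_group normal_unit_cubes by blast

lemma cube_class_mult:
  assumes "u \<in> carrier (quad_units D)" "w \<in> carrier (quad_units D)"
  shows "cube_class D u \<otimes>\<^bsub>cube_quotient D\<^esub> cube_class D w = cube_class D (u * w)"
  using normal.rcos_sum[OF normal_unit_cubes assms]
  by (simp add: cube_class_def cube_quotient_def FactGroup_def) (simp add: quad_units_def)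

lemma cube_class_one: "cube_class D 1 = \<one>\<^bsub>cube_quotient D\<^esub>"
proof -
  interpret comm_group "quad_units D" by (rule comm_group_quad_units)
  have "unit_cubes D \<subseteq> carrier (quad_units D)"
    using subgroup_unit_cubes by (rule subgroup.subset)
  from coset_mult_one[OF this] show ?thesis
    by (simp add: cube_class_def cube_quotient_def FactGroup_def) (simp add: quad_units_def)
qed

lemma subgroup_G3: "subgroup (G3 D) (cube_quotient D)"
proof -
  interpret Q: group "cube_quotient D" by (rule group_cube_quotient)
  have cc: "cube_class D u \<in> carrier (cube_quotient D)" if "u \<in> carrier (quad_units D)" for u
    using that by (auto simp: cube_class_def cube_quotient_def FactGroup_def RCOSETS_def)
  have tau1: "tau D 1 = 1" using tau_quad[of 1 0] by (simp add: quad_def)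
  show ?thesis
  proof (rule Q.subgroupI)
    show "G3 D \<subseteq> carrier (cube_quotient D)" using cc by (auto simp: G3_def)
    have "cube_class D 1 \<in> G3 D"
      unfolding G3_def using one_quad_field tau1
      by (auto simp: quad_units_def intro!: exI[of _ 1])
    thus "G3 D \<noteq> {}" by blast
  next
    fix A assume "A \<in> G3 D"
    then obtain u r where u: "A = cube_class D u" "u \<in> carrier (quad_units D)" "r \<noteq> 0"
      "u * tau D u = of_rat (r ^ 3)" by (auto simp: G3_def)
    have iu: "inverse u \<in> carrier (quad_units D)" "u \<noteq> 0"
      using u quad_units_inverse[of u] by (auto simp: quad_units_def)
    have "tau D u * tau D (inverse u) = tau D (u * inverse u)"
      using iu u by (intro tau_mult[symmetric]) (auto simp: quad_units_def)
    hence "tau D u * tau D (inverse u) = 1" using iu tau1 by simp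
    hence t: "tau D (inverse u) = inverse (tau D u)" by (metis inverse_unique)
    have "inverse u * tau D (inverse u) = inverse (u * tau D u)" by (simp add: t)
    also have "\<dots> = of_rat (inverse r ^ 3)"
      by (simp add: u(4) of_rat_inverse power_inverse of_rat_power)
    finally have "cube_class D (inverse u) \<in> G3 D"
      unfolding G3_def using iu u(3) by (auto intro!: exI[of _ "inverse u"] exI[of _ "inverse r"])
    moreover have "inv\<^bsub>cube_quotient D\<^esub> A = cube_class D (inverse u)"
      using u iu cc by (intro Q.inv_equality) (auto simp: cube_class_mult cube_class_one)
    ultimately show "inv\<^bsub>cube_quotient D\<^esub> A \<in> G3 D" by simp
  next
    fix A B assume "A \<in> G3 D" "B \<in> G3 D"
    then obtain u r w s where u: "A = cube_class D u" "u \<in> carrier (quad_units D)" "r \<noteq> 0"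
      "u * tau D u = of_rat (r ^ 3)" and w: "B = cube_class D w" "w \<in> carrier (quad_units D)"
      "s \<noteq> 0" "w * tau D w = of_rat (s ^ 3)" by (auto simp: G3_def)
    have uw: "u * w \<in> carrier (quad_units D)"
      using u w by (auto simp: quad_units_def quad_field_mult)
    have "(u * w) * tau D (u * w) = (u * tau D u) * (w * tau D w)"
      using u(2) w(2) by (subst tau_mult) (auto simp: quad_units_def)
    also have "\<dots> = of_rat ((r * s) ^ 3)"
      unfolding u(4) w(4) by (simp add: of_rat_mult of_rat_power power_mult_distrib)
    finally show "A \<otimes>\<^bsub>cube_quotient D\<^esub> B \<in> G3 D"
      unfolding u(1) w(1) cube_class_mult[OF u(2) w(2)] G3_def using uw u(3) w(3)
      by (auto intro!: exI[of _ "u * w"] exI[of _ "r * s"])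
  qed
qed

lemma alpha_in_G3:
  assumes "b > 0" and P: "P \<in> E_points D a b"
  shows "alpha D a b P \<in> G3 D"
proof (cases P)
  case Infinity
  interpret Q: group "cube_quotient D" by (rule group_cube_quotient)
  show ?thesis using Infinity subgroup.one_closed[OF subgroup_G3] by simp
next
  case (Affine x y)
  define t where "t = of_int a * x + of_int b"
  have e: "y ^ 2 = x ^ 3 + of_int D * t ^ 2"
    using P Affine by (auto simp: E_points_def t_def)
  have nz: "y \<noteq> 0 \<or> - t \<noteq> 0"
  proof (rule ccontr)
    assume "\<not> (y \<noteq> 0 \<or> - t \<noteq> 0)"
    hence h: "y = 0" "t = 0" by auto
    hence "x = 0" using e by simp
    thus False using h assms(1) by (simp add: t_def)
  qed
  have n: "y * y - of_int D * t * t = x ^ 3" using e by (simp add: power2_eq_square)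
  have "x \<noteq> 0" using quad_norm_nonzero[OF nz] n by (auto simp: power2_eq_square)
  moreover have "quad D y (- t) * tau D (quad D y (- t)) = of_rat (x ^ 3)"
    using n by (simp add: tau_quad quad_mult) (simp add: quad_def)
  moreover have "quad D y (- t) \<in> carrier (quad_units D)"
    using nz by (auto simp: quad_units_def quad_field_def quad_zero_iff)
  ultimately show ?thesis unfolding Affine alpha.simps t_def[symmetric] G3_def by blast
qed

end

end

theory Submission
  imports Defs
begin

text \<open>
  Write \<open>N = v \<tau>(v)\<close>, so that \<open>v\<^sup>2 \<tau>(v) = N v\<close>. Up to the factor \<open>2 / N\<close> the cubic is the
  \<open>\<surd>D\<close>-component of \<open>N v z\<^sup>3 + (a x + b) \<surd>D\<close>, where \<open>z = (X + Y \<surd>D) / Z\<close> and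
  \<open>x = N z \<tau>(z)\<close>. Taking norms in \<open>y - (a x + b) \<surd>D = N v z\<^sup>3\<close> gives \<open>x\<^sup>3 = (N z \<tau>(z))\<^sup>3\<close>, and
  rational cube roots are unique; hence points in the class of \<open>v\<^sup>2 \<tau>(v)\<close> correspond to solutions
  with \<open>Z \<noteq> 0\<close>. A solution with \<open>Z = 0\<close> says that \<open>v z\<^sup>3\<close> is rational, which happens exactly when
  \<open>v\<^sup>2 \<tau>(v)\<close> is a cube, i.e. for the class of the point at infinity. Every class \<open>[u]\<close> with
  \<open>u \<tau>(u) = r\<^sup>3\<close> is represented by \<open>v = u / r\<close>.
\<close>

section \<open>Norm identities and the cubic in rational components\<close>

definition quad_norm :: "int \<Rightarrow> rat \<Rightarrow> rat \<Rightarrow> rat" where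
  "quad_norm D p q = p ^ 2 - of_int D * q ^ 2"

text \<open>The rational and the \<open>\<surd>D\<close>-component of \<open>(v1 + v2 \<surd>D) (X + Y \<surd>D)\<^sup>3\<close>.\<close>

definition twisted_cube_re :: "int \<Rightarrow> rat \<Rightarrow> rat \<Rightarrow> rat \<Rightarrow> rat \<Rightarrow> rat" where
  "twisted_cube_re D v1 v2 X Y =
     v1 * (X ^ 3 + 3 * of_int D * X * Y ^ 2) + of_int D * v2 * (3 * X ^ 2 * Y + of_int D * Y ^ 3)"

definition twisted_cube_im :: "int \<Rightarrow> rat \<Rightarrow> rat \<Rightarrow> rat \<Rightarrow> rat \<Rightarrow> rat" where
  "twisted_cube_im D v1 v2 X Y =
     v1 * (3 * X ^ 2 * Y + of_int D * Y ^ 3) + v2 * (X ^ 3 + 3 * of_int D * X * Y ^ 2)"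

lemma rat_cube_eq_iff: "x ^ 3 = y ^ 3 \<longleftrightarrow> x = (y::rat)"
proof
  assume "x ^ 3 = y ^ 3"
  \<comment> \<open>The second factor is \<open>4 * (x^2 + x * y + y^2)\<close> written as a
    positive definite form, so it vanishes only at the origin.\<close>
  hence "(x - y) * ((2 * x + y) ^ 2 + 3 * y ^ 2) = 0" by algebra
  moreover have "x = 0 \<and> y = 0" if "(2 * x + y) ^ 2 + 3 * y ^ 2 = 0"
    using that zero_le_power2[of "2 * x + y"] zero_le_power2[of y]
    by (auto simp: add_nonneg_eq_0_iff)
  ultimately show "x = y" by auto
qed simp

text \<open>Multiplicativity of the norm, applied to \<open>v * z^3\<close>, in the form of a
  polynomial identity that needs no condition on \<open>D\<close>.\<close>

lemma twisted_cube_norm: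
  "twisted_cube_re D v1 v2 X Y ^ 2 - of_int D * twisted_cube_im D v1 v2 X Y ^ 2
     = quad_norm D v1 v2 * quad_norm D X Y ^ 3"
  unfolding twisted_cube_re_def twisted_cube_im_def quad_norm_def by algebra

text \<open>Multiplying by the norm \<open>N\<close> of \<open>v\<close> clears the only
  denominator. The last summand on the right is \<open>a * x * Z^3\<close> with
  \<open>x = N * (X^2 - D * Y^2) / Z^2\<close>, the abscissa of the point sought.\<close>

lemma descent_cubic_eq:
  assumes "quad_norm D v1 v2 \<noteq> 0"
  shows "quad_norm D v1 v2 * descent_cubic D a b v1 v2 X Y Z =
    2 * (quad_norm D v1 v2 * twisted_cube_im D v1 v2 X Y + of_int b * Z ^ 3
      + of_int a * quad_norm D v1 v2 * quad_norm D X Y * Z)"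
proof -
  define N where "N = v1 ^ 2 - of_int D * v2 ^ 2"
  have N: "N \<noteq> 0" using assms by (simp add: N_def quad_norm_def)
  show ?thesis
    unfolding descent_cubic_def quad_norm_def twisted_cube_im_def N_def[symmetric]
    using N by (simp add: field_simps)
qed

lemma descent_cubic_eq_0_iff:
  assumes "quad_norm D v1 v2 \<noteq> 0"
  shows "descent_cubic D a b v1 v2 X Y Z = 0 \<longleftrightarrow>
    quad_norm D v1 v2 * twisted_cube_im D v1 v2 X Y + of_int b * Z ^ 3
      + of_int a * quad_norm D v1 v2 * quad_norm D X Y * Z = 0"
  using descent_cubic_eq[OF assms, of a b X Y Z] assms
  by (metis mult_eq_0_iff zero_neq_numeral)

section \<open>Homogeneity and integer solutions\<close>

lemma descent_cubic_scale:
  "descent_cubic D a b v1 v2 (k * X) (k * Y) (k * Z) = k ^ 3 * descent_cubic D a b v1 v2 X Y Z"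
  unfolding descent_cubic_def
  by (simp add: algebra_simps power_mult_distrib power2_eq_square power3_eq_cube)

text \<open>Serves twice: a common denominator as \<open>k\<close> gives integer solutions, and
  \<open>inverse Z\<close> as \<open>k\<close> normalises \<open>Z\<close> to 1.\<close>

lemma cubic_solution_scale:
  assumes "k \<noteq> 0"
  shows "cubic_solution D a b v1 v2 (k * X) (k * Y) (k * Z) \<longleftrightarrow> cubic_solution D a b v1 v2 X Y Z"
  using assms by (simp add: cubic_solution_def descent_cubic_scale)

lemma rat_times_denominator: "x * of_int (snd (quotient_of x)) = of_int (fst (quotient_of x))"
  using quotient_of_div[of x "fst (quotient_of x)" "snd (quotient_of x)"]
    quotient_of_denom_pos'[of x] by (simp add: field_simps)

lemma int_solvable_iff_rat_solvable: "int_solvable D a b v1 v2 \<longleftrightarrow> rat_solvable D a b v1 v2"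
proof
  assume "rat_solvable D a b v1 v2"
  then obtain X Y Z where s: "cubic_solution D a b v1 v2 X Y Z" by (auto simp: rat_solvable_def)
  define n where "n t = fst (quotient_of t)" for t
  define d where "d t = snd (quotient_of t)" for t
  have d: "d t > 0" for t by (simp add: d_def quotient_of_denom_pos')
  have nd: "of_int (n t) = t * of_int (d t)" for t
    using rat_times_denominator[of t] by (simp add: n_def d_def)
  define k where "k = d X * d Y * d Z"
  have "k > 0" unfolding k_def by (intro mult_pos_pos d)
  hence "cubic_solution D a b v1 v2 (of_int k * X) (of_int k * Y) (of_int k * Z)"
    using s by (subst cubic_solution_scale) auto
  moreover have "of_int k * X = of_int (n X * d Y * d Z)"
    "of_int k * Y = of_int (d X * n Y * d Z)" "of_int k * Z = of_int (d X * d Y * n Z)"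
    by (simp_all add: k_def nd)
  ultimately show "int_solvable D a b v1 v2" unfolding int_solvable_def by metis
qed (auto simp: int_solvable_def rat_solvable_def)

section \<open>Components and cube classes in the quadratic field\<close>

lemma of_rat_minus_eq_quad:
  "of_rat y - (of_int a * of_rat x + of_int b) * csqrt (of_int D)
     = quad D y (- (of_int a * x + of_int b))"
  by (simp add: quad_def of_rat_minus of_rat_add of_rat_mult del: minus_add_distrib)

lemma quad_divide_of_rat: "quad D X Y / of_rat Z = quad D (X / Z) (Y / Z)"
  by (simp add: quad_def of_rat_divide add_divide_distrib)

context
  fixes D :: int
  assumes D: "fundamental_discriminant D" "D \<noteq> 1"
begin

lemma quad_in_units_iff: "quad D p q \<in> carrier (quad_units D) \<longleftrightarrow> p \<noteq> 0 \<or> q \<noteq> 0"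
  using quad_zero_iff[OF D] by (auto simp: quad_units_def quad_field_def)

lemma quad_units_cases:
  assumes "z \<in> carrier (quad_units D)"
  obtains p q where "z = quad D p q" "p \<noteq> 0 \<or> q \<noteq> 0"
  using assms quad_zero_iff[OF D] by (auto simp: quad_units_def quad_field_def)

lemma quad_norm_neq_0:
  "quad D p q \<in> carrier (quad_units D) \<Longrightarrow> quad_norm D p q \<noteq> 0"
  using quad_norm_nonzero[OF D] by (simp add: quad_in_units_iff quad_norm_def)

lemma quad_mult_tau: "quad D p q * tau D (quad D p q) = of_rat (quad_norm D p q)"
  by (simp add: tau_quad[OF D] quad_mult[OF D] quad_norm_def power2_eq_square mult.assoc)
    (simp add: quad_def)

lemma of_rat_mult_quad: "of_rat r * quad D p q = quad D (r * p) (r * q)"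
  by (simp add: quad_def of_rat_mult algebra_simps)

lemma quad_square_mult_tau:
  "quad D p q ^ 2 * tau D (quad D p q) = of_rat (quad_norm D p q) * quad D p q"
  by (simp add: power2_eq_square quad_mult_tau[symmetric])

lemma quad_mult_cube:
  "quad D v1 v2 * quad D X Y ^ 3
     = quad D (twisted_cube_re D v1 v2 X Y) (twisted_cube_im D v1 v2 X Y)"
  unfolding power3_eq_cube quad_mult[OF D] quad_eq_iff[OF D]
    twisted_cube_re_def twisted_cube_im_def
  by (intro conjI) algebra+

text \<open>Since \<open>v^2 * tau(v)\<close> is a rational multiple of \<open>v\<close>, an
  equation \<open>w = u * z^3\<close> in the field splits into two equations between
  rationals.\<close>

lemma quad_square_mult_tau_mult_cube:
  "quad D v1 v2 ^ 2 * tau D (quad D v1 v2) * quad D X Y ^ 3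
     = quad D (quad_norm D v1 v2 * twisted_cube_re D v1 v2 X Y)
         (quad_norm D v1 v2 * twisted_cube_im D v1 v2 X Y)"
  unfolding of_rat_mult_quad[symmetric]
  by (simp only: quad_square_mult_tau quad_mult_cube mult.assoc)

lemma quad_square_mult_tau_in_units:
  assumes "quad D p q \<in> carrier (quad_units D)"
  shows "quad D p q ^ 2 * tau D (quad D p q) \<in> carrier (quad_units D)"
  using assms quad_norm_neq_0[OF assms]
  unfolding quad_square_mult_tau of_rat_mult_quad quad_in_units_iff by simp

text \<open>Cosets of the cubes agree once one contains a representative of the other. The explicit
  \<open>z\<close> is what supplies the coordinates of a solution.\<close>

lemma cube_class_eq_iff:
  assumes "u \<in> carrier (quad_units D)" "w \<in> carrier (quad_units D)"
  shows "cube_class D u = cube_class D w \<longleftrightarrow> (\<exists>z\<in>carrier (quad_units D). u = w * z ^ 3)"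
proof -
  interpret comm_group "quad_units D" by (rule comm_group_quad_units[OF D])
  note sub = subgroup_unit_cubes[OF D]
  have mem: "x \<in> cube_class D w \<longleftrightarrow> (\<exists>z\<in>carrier (quad_units D). x = w * z ^ 3)" for x
    unfolding cube_class_def r_coset_def unit_cubes_def
    by (auto simp: quad_units_def mult.commute)
  have "cube_class D u = cube_class D w \<longleftrightarrow> u \<in> cube_class D w"
    using rcos_self[OF assms(1) sub] repr_independence[OF _ assms(2) sub, of u]
    unfolding cube_class_def by auto
  thus ?thesis by (simp add: mem)
qed

lemma G3_represented:
  assumes "U \<in> G3 D"
  obtains v1 v2 where "represents D U v1 v2"
proof -
  obtain u r where u: "U = cube_class D u" "u \<in> carrier (quad_units D)" "r \<noteq> 0"
    "u * tau D u = of_rat (r ^ 3)" using assms by (auto simp: G3_def)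
  obtain p q where pq: "u = quad D p q" "p \<noteq> 0 \<or> q \<noteq> 0" by (rule quad_units_cases[OF u(2)])
  have "quad_norm D p q = r ^ 3" using u(4) unfolding pq(1) quad_mult_tau of_rat_eq_iff .
  \<comment> \<open>The norm of \<open>v = u / r\<close> is \<open>r^3 / r^2 = r\<close>, so
    \<open>v^2 * tau(v) = r * v\<close> equals \<open>u\<close> itself, not just up to a
    cube.\<close>
  hence "quad_norm D (p / r) (q / r) = r"
    using u(3) by (simp add: quad_norm_def power_divide flip: diff_divide_distrib)
      (simp add: power2_eq_square power3_eq_cube)
  hence "quad D (p / r) (q / r) ^ 2 * tau D (quad D (p / r) (q / r)) = u"
    using u(3) unfolding quad_square_mult_tau of_rat_mult_quad pq(1) by simp
  hence "represents D U (p / r) (q / r)"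
    using u(1,3) pq(2) by (simp add: represents_def quad_in_units_iff)
  thus thesis by (rule that)
qed

section \<open>Points on the curve and solutions with \<open>Z = 1\<close>\<close>

lemma cubic_solution_of_point:
  assumes v: "quad D v1 v2 \<in> carrier (quad_units D)"
    and P: "Affine x y \<in> E_points D a b"
    and e: "quad D y (- (of_int a * x + of_int b))
      = quad D v1 v2 ^ 2 * tau D (quad D v1 v2) * quad D z1 z2 ^ 3"
  shows "cubic_solution D a b v1 v2 z1 z2 1"
proof -
  define N where "N = quad_norm D v1 v2"
  have N: "N \<noteq> 0" using quad_norm_neq_0[OF v] by (simp add: N_def)
  define R where "R = twisted_cube_re D v1 v2 z1 z2"
  define I where "I = twisted_cube_im D v1 v2 z1 z2"
  have y: "y = N * R" and t: "of_int a * x + of_int b = - (N * I)"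
    using e unfolding quad_square_mult_tau_mult_cube quad_eq_iff[OF D] N_def R_def I_def by auto
  have "y ^ 2 = x ^ 3 + of_int D * (of_int a * x + of_int b) ^ 2"
    using P by (simp add: E_points_def)
  \<comment> \<open>The curve equation makes \<open>x^3\<close> the norm of
    \<open>y - (a x + b) sqrt D\<close>. Computed as the norm of \<open>N * v * z^3\<close>, it is a
    cube too, and this determines \<open>x\<close>.\<close>
  hence "x ^ 3 = N ^ 2 * (R ^ 2 - of_int D * I ^ 2)"
    unfolding y t by (simp add: algebra_simps power_mult_distrib)
  also have "\<dots> = (N * quad_norm D z1 z2) ^ 3"
    unfolding R_def I_def twisted_cube_norm N_def by algebra
  finally have x: "x = N * quad_norm D z1 z2" by (simp only: rat_cube_eq_iff)
  have "N * I + of_int b * 1 ^ 3 + of_int a * N * quad_norm D z1 z2 * 1 = 0"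
    using t unfolding x by (simp add: algebra_simps)
  thus ?thesis
    using descent_cubic_eq_0_iff[of D v1 v2 a b z1 z2 1] N
    by (simp add: cubic_solution_def N_def I_def)
qed

text \<open>Here \<open>y\<close> is chosen as the rational component of \<open>u * z^3\<close>. The
  cubic forces the other component to be \<open>-(a x + b)\<close>, and taking norms then gives the
  curve equation.\<close>

lemma point_of_cubic_solution:
  assumes v: "quad D v1 v2 \<in> carrier (quad_units D)" and "b > 0"
    and s: "cubic_solution D a b v1 v2 X Y 1"
  defines "x \<equiv> quad_norm D v1 v2 * quad_norm D X Y"
    and "y \<equiv> quad_norm D v1 v2 * twisted_cube_re D v1 v2 X Y"
  shows "Affine x y \<in> E_points D a b"
    and "quad D y (- (of_int a * x + of_int b))
      = quad D v1 v2 ^ 2 * tau D (quad D v1 v2) * quad D X Y ^ 3"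
    and "quad D X Y \<in> carrier (quad_units D)"
proof -
  define N where "N = quad_norm D v1 v2"
  have N: "N \<noteq> 0" using quad_norm_neq_0[OF v] by (simp add: N_def)
  define R where "R = twisted_cube_re D v1 v2 X Y"
  define I where "I = twisted_cube_im D v1 v2 X Y"
  have c: "N * I + of_int b + of_int a * N * quad_norm D X Y = 0"
    using s descent_cubic_eq_0_iff[of D v1 v2 a b X Y 1] N
    by (simp add: cubic_solution_def N_def I_def)
  have t: "of_int a * x + of_int b = - (N * I)"
    using c unfolding x_def N_def[symmetric] by (simp add: algebra_simps)
  show "quad D y (- (of_int a * x + of_int b))
      = quad D v1 v2 ^ 2 * tau D (quad D v1 v2) * quad D X Y ^ 3"
    unfolding quad_square_mult_tau_mult_cube t y_def N_def I_def by simp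
  have "y ^ 2 - of_int D * (- (N * I)) ^ 2 = N ^ 2 * (R ^ 2 - of_int D * I ^ 2)"
    unfolding y_def N_def[symmetric] R_def[symmetric] by algebra
  also have "\<dots> = x ^ 3"
    unfolding R_def I_def twisted_cube_norm x_def N_def by algebra
  finally show "Affine x y \<in> E_points D a b"
    using t by (simp add: E_points_def algebra_simps)
  \<comment> \<open>At \<open>X = Y = 0\<close> the cubic reduces to \<open>b = 0\<close>.\<close>
  have "X \<noteq> 0 \<or> Y \<noteq> 0"
  proof (rule ccontr)
    assume "\<not> (X \<noteq> 0 \<or> Y \<noteq> 0)"
    thus False using c \<open>b > 0\<close> by (simp add: I_def twisted_cube_im_def quad_norm_def)
  qed
  thus "quad D X Y \<in> carrier (quad_units D)" by (simp add: quad_in_units_iff)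
qed

section \<open>Solutions with \<open>Z = 0\<close> and the trivial class\<close>

lemma cube_class_one_if_solution_at_infinity:
  assumes v: "quad D v1 v2 \<in> carrier (quad_units D)"
    and s: "cubic_solution D a b v1 v2 X Y 0"
  shows "cube_class D (quad D v1 v2 ^ 2 * tau D (quad D v1 v2)) = \<one>\<^bsub>cube_quotient D\<^esub>"
proof -
  define N where "N = quad_norm D v1 v2"
  have N: "N \<noteq> 0" using quad_norm_neq_0[OF v] by (simp add: N_def)
  define R where "R = twisted_cube_re D v1 v2 X Y"
  define n where "n = quad_norm D X Y"
  have xy: "quad D X Y \<in> carrier (quad_units D)"
    using s by (simp add: cubic_solution_def quad_in_units_iff)
  have n: "n \<noteq> 0" using quad_norm_neq_0[OF xy] by (simp add: n_def)
  have I: "twisted_cube_im D v1 v2 X Y = 0"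
    using s descent_cubic_eq_0_iff[of D v1 v2 a b X Y 0] N
    by (simp add: cubic_solution_def N_def)
  \<comment> \<open>With \<open>I\<close> zero, \<open>v * z^3\<close> is the rational number
    \<open>R\<close>, and this is its norm.\<close>
  have R2: "R ^ 2 = N * n ^ 3"
    using twisted_cube_norm[of D v1 v2 X Y] by (simp add: I R_def N_def n_def)
  hence R: "R \<noteq> 0" using N n by auto
  \<comment> \<open>Multiplying the last identity by \<open>R\<close> gives
    \<open>N * R = (R / n)^3\<close>, so \<open>u * z^3\<close> is the cube of \<open>k\<close> and
    \<open>u\<close> is the cube of \<open>k / z\<close>.\<close>
  define k where "k = R / n"
  have k: "k \<noteq> 0" using R n by (simp add: k_def)
  have NR: "N * R = k ^ 3"
  proof -
    have "N * R * n ^ 3 = R ^ 2 * R" using R2 by simp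
    also have "\<dots> = R ^ 3" by (simp add: power2_eq_square power3_eq_cube)
    finally show ?thesis using n by (simp add: k_def power_divide field_simps)
  qed
  let ?u = "quad D v1 v2 ^ 2 * tau D (quad D v1 v2)"
  have "?u * quad D X Y ^ 3 = of_rat k ^ 3"
    unfolding quad_square_mult_tau_mult_cube I N_def[symmetric] R_def[symmetric] NR
    by (simp add: quad_def of_rat_power)
  moreover have nz: "quad D X Y \<noteq> 0" using xy by (simp add: quad_units_def)
  \<comment> \<open>The factor 1 fits \<open>cube_class_eq_iff\<close> with
    \<open>w = 1\<close>.\<close>
  ultimately have u: "?u = 1 * (of_rat k * inverse (quad D X Y)) ^ 3"
    by (simp add: field_simps)
  have "inverse (quad D X Y) \<in> carrier (quad_units D)"
    using quad_units_inverse[OF D, of "quad D X Y"] xy by (simp add: quad_units_def)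
  then obtain p q where pq: "inverse (quad D X Y) = quad D p q" "p \<noteq> 0 \<or> q \<noteq> 0"
    by (rule quad_units_cases)
  have "of_rat k * inverse (quad D X Y) \<in> carrier (quad_units D)"
    using pq(2) k unfolding pq(1) of_rat_mult_quad quad_in_units_iff by simp
  moreover have "1 \<in> carrier (quad_units D)"
    using one_quad_field[OF D] by (simp add: quad_units_def)
  ultimately have "cube_class D ?u = cube_class D 1"
    using u cube_class_eq_iff[OF quad_square_mult_tau_in_units[OF v], of 1] by blast
  thus ?thesis by (simp add: cube_class_one[OF D])
qed

lemma solution_at_infinity_if_cube_class_one:
  assumes v: "quad D v1 v2 \<in> carrier (quad_units D)"
    and c: "cube_class D (quad D v1 v2 ^ 2 * tau D (quad D v1 v2)) = \<one>\<^bsub>cube_quotient D\<^esub>"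
  shows "rat_solvable D a b v1 v2"
proof -
  define N where "N = quad_norm D v1 v2"
  have N: "N \<noteq> 0" using quad_norm_neq_0[OF v] by (simp add: N_def)
  let ?u = "quad D v1 v2 ^ 2 * tau D (quad D v1 v2)"
  have one: "1 \<in> carrier (quad_units D)"
    using one_quad_field[OF D] by (simp add: quad_units_def)
  \<comment> \<open>With 1 on the left, the cube root obtained satisfies \<open>1 = u * z^3\<close>,
    so the components of \<open>z\<close> themselves are the solution, with
    \<open>Z = 0\<close>.\<close>
  have "cube_class D 1 = cube_class D ?u" using c by (simp add: cube_class_one[OF D])
  then obtain z where z: "z \<in> carrier (quad_units D)" "1 = ?u * z ^ 3"
    using cube_class_eq_iff[OF one quad_square_mult_tau_in_units[OF v]] by blast
  obtain p q where pq: "z = quad D p q" "p \<noteq> 0 \<or> q \<noteq> 0" by (rule quad_units_cases[OF z(1)])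
  have "quad D 1 0 = ?u * quad D p q ^ 3" using z(2) pq(1) by (simp add: quad_def)
  hence "twisted_cube_im D v1 v2 p q = 0"
    using N unfolding quad_square_mult_tau_mult_cube quad_eq_iff[OF D] by (simp add: N_def)
  hence "cubic_solution D a b v1 v2 p q 0"
    using pq(2) N descent_cubic_eq_0_iff[of D v1 v2 a b p q 0]
    by (simp add: cubic_solution_def N_def)
  thus ?thesis unfolding rat_solvable_def by blast
qed

section \<open>General solutions and the image of \<open>alpha\<close>\<close>

lemma point_of_solution_general:
  assumes v: "quad D v1 v2 \<in> carrier (quad_units D)" and "b > 0"
    and s: "cubic_solution D a b v1 v2 X Y Z" and Z: "Z \<noteq> 0"
  shows "\<exists>x y.
    of_rat x = quad D v1 v2 * tau D (quad D v1 v2)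
                 * of_rat ((X ^ 2 - of_int D * Y ^ 2) / Z ^ 2) \<and>
    of_rat y = quad D v1 v2 * tau D (quad D v1 v2)
                 * quad_Re D (quad D v1 v2 * quad D X Y ^ 3) / of_rat (Z ^ 3) \<and>
    Affine x y \<in> E_points D a b \<and>
    alpha D a b (Affine x y) = cube_class D (quad D v1 v2 ^ 2 * tau D (quad D v1 v2)) \<and>
    of_rat y - (of_int a * of_rat x + of_int b) * csqrt (of_int D)
      = quad D v1 v2 ^ 2 * tau D (quad D v1 v2) * (quad D X Y / of_rat Z) ^ 3"
proof -
  let ?X = "X / Z" and ?Y = "Y / Z"
  define x where "x = quad_norm D v1 v2 * quad_norm D ?X ?Y"
  define y where "y = quad_norm D v1 v2 * twisted_cube_re D v1 v2 ?X ?Y"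
  \<comment> \<open>Homogeneity reduces to \<open>Z = 1\<close>; what remains is to rewrite the
    rational coordinates through \<open>tau\<close> and \<open>quad_Re\<close>.\<close>
  have "cubic_solution D a b v1 v2 ?X ?Y 1"
    using s Z cubic_solution_scale[of "inverse Z" D a b v1 v2 X Y Z]
    by (simp add: field_simps)
  note P = point_of_cubic_solution[OF v \<open>b > 0\<close> this, folded x_def y_def]
  have "quad_norm D ?X ?Y = (X ^ 2 - of_int D * Y ^ 2) / Z ^ 2"
    by (simp add: quad_norm_def power_divide diff_divide_distrib)
  hence 1: "of_rat x = quad D v1 v2 * tau D (quad D v1 v2)
      * of_rat ((X ^ 2 - of_int D * Y ^ 2) / Z ^ 2)"
    unfolding quad_mult_tau x_def of_rat_mult by simp
  have "twisted_cube_re D v1 v2 ?X ?Y = twisted_cube_re D v1 v2 X Y / Z ^ 3"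
    by (simp add: twisted_cube_re_def power_divide add_divide_distrib distrib_left
        power2_eq_square power3_eq_cube)
  moreover have "quad_Re D (quad D v1 v2 * quad D X Y ^ 3) = of_rat (twisted_cube_re D v1 v2 X Y)"
    unfolding quad_mult_cube quad_Re_def tau_quad[OF D] by (simp add: quad_def of_rat_minus)
  ultimately have 2: "of_rat y = quad D v1 v2 * tau D (quad D v1 v2)
      * quad_Re D (quad D v1 v2 * quad D X Y ^ 3) / of_rat (Z ^ 3)"
    unfolding quad_mult_tau y_def by (simp add: of_rat_mult of_rat_divide)
  have u: "quad D v1 v2 ^ 2 * tau D (quad D v1 v2) \<in> carrier (quad_units D)"
    by (rule quad_square_mult_tau_in_units[OF v])
  \<comment> \<open>Comparing classes requires \<open>y - (a x + b) sqrt D\<close> to be nonzero,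
    which follows from its factorisation as \<open>u * z^3\<close>.\<close>
  have "quad D ?X ?Y ^ 3 \<in> unit_cubes D" using P(3) by (auto simp: unit_cubes_def)
  hence "quad D ?X ?Y ^ 3 \<in> carrier (quad_units D)"
    using subgroup.subset[OF subgroup_unit_cubes[OF D]] by blast
  hence "quad D y (- (of_int a * x + of_int b)) \<in> carrier (quad_units D)"
    using u unfolding P(2) by (simp add: quad_units_def quad_field_mult[OF D])
  hence "alpha D a b (Affine x y) = cube_class D (quad D v1 v2 ^ 2 * tau D (quad D v1 v2))"
    using cube_class_eq_iff[OF _ u] P(2,3) by auto
  thus ?thesis
    using 1 2 P(1,2) unfolding of_rat_minus_eq_quad quad_divide_of_rat by blast
qed

text \<open>Only the right-hand side involves the representative, so solvability is the same for all
  representatives of \<open>U\<close>.\<close>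

lemma image_alpha_iff_rat_solvable:
  assumes "b > 0" and r: "represents D U v1 v2"
  shows "U \<in> alpha D a b ` E_points D a b \<longleftrightarrow> rat_solvable D a b v1 v2"
proof
  have v: "quad D v1 v2 \<in> carrier (quad_units D)"
    and U: "cube_class D (quad D v1 v2 ^ 2 * tau D (quad D v1 v2)) = U"
    using r by (auto simp: represents_def)
  let ?u = "quad D v1 v2 ^ 2 * tau D (quad D v1 v2)"
  {
    assume "U \<in> alpha D a b ` E_points D a b"
    then obtain P where P: "P \<in> E_points D a b" "U = alpha D a b P" by blast
    show "rat_solvable D a b v1 v2"
    proof (cases P)
      case Infinity
      thus ?thesis using solution_at_infinity_if_cube_class_one[OF v] U P(2) by simp
    next
      case (Affine x y)
      let ?w = "quad D y (- (of_int a * x + of_int b))"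
      \<comment> \<open>If both vanished, the curve equation would give \<open>x = 0\<close> and
        hence \<open>b = 0\<close>.\<close>
      have "y \<noteq> 0 \<or> of_int a * x + of_int b \<noteq> 0"
      proof (rule ccontr)
        assume "\<not> (y \<noteq> 0 \<or> of_int a * x + of_int b \<noteq> 0)"
        hence h: "y = 0" "of_int a * x + of_int b = 0" by auto
        hence "x = 0" using P(1) Affine by (simp add: E_points_def)
        thus False using h \<open>b > 0\<close> by simp
      qed
      hence w: "?w \<in> carrier (quad_units D)" unfolding quad_in_units_iff by linarith
      have "cube_class D ?w = cube_class D ?u" using U P(2) Affine by simp
      then obtain z where z: "z \<in> carrier (quad_units D)" "?w = ?u * z ^ 3"
        using cube_class_eq_iff[OF w quad_square_mult_tau_in_units[OF v]] by blast
      obtain p q where "z = quad D p q" by (rule quad_units_cases[OF z(1)])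
      thus ?thesis
        using cubic_solution_of_point[OF v, of x y a b p q] P(1) Affine z(2)
        unfolding rat_solvable_def by blast
    qed
  next
    assume "rat_solvable D a b v1 v2"
    then obtain X Y Z where s: "cubic_solution D a b v1 v2 X Y Z"
      by (auto simp: rat_solvable_def)
    show "U \<in> alpha D a b ` E_points D a b"
    proof (cases "Z = 0")
      case True
      hence "U = alpha D a b Infinity"
        using cube_class_one_if_solution_at_infinity[OF v] s U by simp
      thus ?thesis by (auto simp: E_points_def)
    next
      case False
      thus ?thesis using point_of_solution_general[OF v \<open>b > 0\<close> s] U by blast
    qed
  }
qed

end

theorem theorem4p1:
  fixes a b D b1 b3 :: int
  assumes "fundamental_discriminant D" and "D \<noteq> 1"
    and "b > 0" and "4 * D * a ^ 3 \<noteq> 27 * b"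
    and "b = b1 * b3 ^ 3" and "cubefree b1" and "coprime a b3"
  shows
    "(\<forall>U \<in> G3 D.
        (U \<in> alpha D a b ` E_points D a b \<longleftrightarrow>
           (\<exists>v1 v2. represents D U v1 v2 \<and> int_solvable D a b v1 v2)) \<and>
        (U \<in> alpha D a b ` E_points D a b \<longleftrightarrow>
           (\<forall>v1 v2. represents D U v1 v2 \<longrightarrow> int_solvable D a b v1 v2)) \<and>
        (U \<in> alpha D a b ` E_points D a b \<longleftrightarrow>
           (\<exists>v1 v2. represents D U v1 v2 \<and> rat_solvable D a b v1 v2)) \<and>
        (U \<in> alpha D a b ` E_points D a b \<longleftrightarrow>
           (\<forall>v1 v2. represents D U v1 v2 \<longrightarrow> rat_solvable D a b v1 v2)))
     \<and> cubic_solution D a b 1 0 1 0 0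
     \<and> (\<forall>v1 v2 x y z1 z2.
          quad D v1 v2 \<in> carrier (quad_units D) \<and>
          quad D z1 z2 \<in> carrier (quad_units D) \<and>
          Affine x y \<in> E_points D a b \<and>
          of_rat y - (of_int a * of_rat x + of_int b) * csqrt (of_int D)
            = quad D v1 v2 ^ 2 * tau D (quad D v1 v2) * quad D z1 z2 ^ 3
          \<longrightarrow> cubic_solution D a b v1 v2 z1 z2 1)
     \<and> (\<forall>v1 v2 X Y Z.
          quad D v1 v2 \<in> carrier (quad_units D) \<and>
          cubic_solution D a b v1 v2 X Y Z \<and> Z \<noteq> 0
          \<longrightarrow> (\<exists>x y.
                of_rat x = quad D v1 v2 * tau D (quad D v1 v2)
                             * of_rat ((X ^ 2 - of_int D * Y ^ 2) / Z ^ 2) \<and>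
                of_rat y = quad D v1 v2 * tau D (quad D v1 v2)
                             * quad_Re D (quad D v1 v2 * quad D X Y ^ 3) / of_rat (Z ^ 3) \<and>
                Affine x y \<in> E_points D a b \<and>
                alpha D a b (Affine x y)
                  = cube_class D (quad D v1 v2 ^ 2 * tau D (quad D v1 v2)) \<and>
                of_rat y - (of_int a * of_rat x + of_int b) * csqrt (of_int D)
                  = quad D v1 v2 ^ 2 * tau D (quad D v1 v2) * (quad D X Y / of_rat Z) ^ 3))"
proof (intro conjI ballI)
  note D = assms(1,2) and iff = image_alpha_iff_rat_solvable[OF assms(1-3)]
  fix U assume "U \<in> G3 D"
  \<comment> \<open>One representative must exist: otherwise the universal conditions would hold
    vacuously and the existential ones would fail.\<close>
  then obtain w1 w2 where w: "represents D U w1 w2" by (rule G3_represented[OF D])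
  show "U \<in> alpha D a b ` E_points D a b \<longleftrightarrow>
      (\<exists>v1 v2. represents D U v1 v2 \<and> int_solvable D a b v1 v2)"
    "U \<in> alpha D a b ` E_points D a b \<longleftrightarrow>
      (\<forall>v1 v2. represents D U v1 v2 \<longrightarrow> int_solvable D a b v1 v2)"
    "U \<in> alpha D a b ` E_points D a b \<longleftrightarrow>
      (\<exists>v1 v2. represents D U v1 v2 \<and> rat_solvable D a b v1 v2)"
    "U \<in> alpha D a b ` E_points D a b \<longleftrightarrow>
      (\<forall>v1 v2. represents D U v1 v2 \<longrightarrow> rat_solvable D a b v1 v2)"
    unfolding int_solvable_iff_rat_solvable using iff w by blast+
next
  show "cubic_solution D a b 1 0 1 0 0" by (simp add: cubic_solution_def descent_cubic_def)
qed (use cubic_solution_of_point[OF assms(1,2)] point_of_solution_general[OF assms(1,2) _ assms(3)]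
  in \<open>unfold of_rat_minus_eq_quad, blast+\<close>)

end
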